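(* Let $k$ be an arbitrary field. Let $u,v$ and $x,y$ be two pairs of variables related by a change of variables $$u=f(x,y),\qquad v=g(x,y),$$ where $f\in k((x))[[y]]$ satisfies $f(x,0)\in xk[[x]]\smallsetminus x^2k[[x]]$ and $g\in yk((x))[[y]]\smallsetminus y^2k((x))[[y]]$. Then for every formal $2$-form $\omega=h(u,v)\,du\wedge dv\in\Omega^2_{k((u))((v))/k}$, with $h\in k((u))((v))$, the $(u,v)$-$2$-residue and the $(x,y)$-$2$-residue of $\omega$ coincide: $$(u,v)\mathrm{res}^2(\omega)=(x,y)\mathrm{res}^2(\omega).$$
   Context: An element $h\in k((u))((v))$ is written $h=\sum_{j\ge l}h_j(u)v^j$ with $h_j(u)=\sum_{i\ge l_j}h_{i,j}u^i\in k((u))$. The space $\Omega^2_{k((u))((v))/k}$ of formal $2$-forms is understood as the one-dimensional $k((u))((v))$-vector space with basis $du\wedge dv$, where differentials of series are computed with formal partial derivatives. The $(u,v)$-$2$-residue of $\omega=h\,du\wedge dv$ is $(u,v)\mathrm{res}^2(\omega):=h_{-1,-1}\in k$, the coefficient of $u^{-1}v^{-1}$ in $h$. A change of variables of the form $u=f(x,y)$, $v=g(x,y)$, where $f\in k((x))[[y]]$ satisfies $f(x,0)\in xk[[x]]\smallsetminus x^2k[[x]]$ and $g\in yk((x))[[y]]\smallsetminus y^2k((x))[[y]]$, induces a field isomorphism $k((u))((v))\to k((x))((y))$, $h\mapsto h(f,g)=\sum_j\big(\sum_i h_{i,j}f^i\big)g^j$; the sums converge for the topology on $k((x))[[y]]$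 of coefficientwise convergence, each coefficient of $y^j$ converging $x$-adically in $k((x))$. It sends $\omega=h\,du\wedge dv$ to $h(f,g)\left(\frac{\partial f}{\partial x}\frac{\partial g}{\partial y}-\frac{\partial f}{\partial y}\frac{\partial g}{\partial x}\right)dx\wedge dy$. The $(x,y)$-$2$-residue $(x,y)\mathrm{res}^2(\omega)$ is the coefficient of $x^{-1}y^{-1}$ of $h(f,g)\left(\frac{\partial f}{\partial x}\frac{\partial g}{\partial y}-\frac{\partial f}{\partial y}\frac{\partial g}{\partial x}\right)$. *)

theory Defs
  imports "HOL-Analysis.Infinite_Sum" "HOL-Computational_Algebra.Formal_Laurent_Series"
begin

text \<open>
  The field \<open>k((u))((v))\<close> is rendered as \<open>'k fls fls\<close>: the outer series is in \<open>v\<close>, its coefficients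
  are series in \<open>u\<close>, so that \<open>h\<^sub>i\<^sub>j = fls_nth (fls_nth h j) i\<close>. Likewise \<open>k((x))[[y]]\<close> is
  \<open>'k fls fps\<close>. A 2-form \<open>h du \<and> dv\<close> is represented by its coefficient \<open>h\<close> with respect to the basis
  \<open>du \<and> dv\<close> of the one-dimensional space of formal 2-forms.
\<close>

definition residue2 :: "'k::zero fls fls \<Rightarrow> 'k" where
  "residue2 h = fls_nth (fls_nth h (-1)) (-1)"

text \<open>
  Sums with respect to coefficientwise convergence: the coefficient of each \<open>y\<^sup>n\<close> is summed in
  \<open>k((x))\<close> with the \<open>x\<close>-adic topology, which is the topology of the library's metric on \<open>'k fls\<close>.
  (The metric on \<open>'k fls fls\<close> itself is \<open>y\<close>-adic with discrete coefficients and is not the right one.)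
\<close>

definition coeffwise_infsum :: "(int \<Rightarrow> 'k::field fls fls) \<Rightarrow> 'k fls fls" where
  "coeffwise_infsum S = Abs_fls (\<lambda>n. \<Sum>\<^sub>\<infinity>i\<in>UNIV. fls_nth (S i) n)"

text \<open>
  \<open>c(f) = \<Sum>\<^sub>i c\<^sub>i f\<^sup>i\<close> for \<open>c \<in> k((u))\<close> and \<open>h(f,g) = \<Sum>\<^sub>j h\<^sub>j(f) g\<^sup>j\<close> for \<open>h \<in> k((u))((v))\<close>. All integer
  indices may be summed over, as coefficients of sufficiently negative index vanish.
\<close>

definition subst1 :: "'k::field fls fps \<Rightarrow> 'k fls \<Rightarrow> 'k fls fls" where
  "subst1 f c = coeffwise_infsum
     (\<lambda>i. fls_const (fls_const (fls_nth c i)) * fps_to_fls f powi i)"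

definition subst2 :: "'k::field fls fps \<Rightarrow> 'k fls fps \<Rightarrow> 'k fls fls \<Rightarrow> 'k fls fls" where
  "subst2 f g h = coeffwise_infsum (\<lambda>j. subst1 f (fls_nth h j) * fps_to_fls g powi j)"

definition deriv_x :: "'k::field fls fps \<Rightarrow> 'k fls fps" where
  "deriv_x F = Abs_fps (\<lambda>n. fls_deriv (fps_nth F n))"

definition deriv_y :: "'k::field fls fps \<Rightarrow> 'k fls fps" where
  "deriv_y F = fps_deriv F"

definition jacobian :: "'k::field fls fps \<Rightarrow> 'k fls fps \<Rightarrow> 'k fls fps" where
  "jacobian f g = deriv_x f * deriv_y g - deriv_y f * deriv_x g"

text \<open>The coefficient with respect to \<open>dx \<and> dy\<close> of the form \<open>h du \<and> dv\<close> with \<open>u = f\<close>, \<open>v = g\<close>.\<close>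

definition change_of_vars_form ::
    "'k::field fls fps \<Rightarrow> 'k fls fps \<Rightarrow> 'k fls fls \<Rightarrow> 'k fls fls" where
  "change_of_vars_form f g h = subst2 f g h * fps_to_fls (jacobian f g)"

text \<open>
  Divisibility by \<open>fps_X ^ m\<close> is taken in \<open>k[[x]]\<close> in the first conjunct, and in \<open>k((x))[[y]]\<close> in the
  other two.
\<close>

definition admissible_change :: "'k::field fls fps \<Rightarrow> 'k fls fps \<Rightarrow> bool" where
  "admissible_change f g \<longleftrightarrow>
     (\<exists>p :: 'k fps. fps_nth f 0 = fps_to_fls p \<and> fps_X dvd p \<and> \<not> fps_X ^ 2 dvd p) \<and>
     fps_X dvd g \<and> \<not> fps_X ^ 2 dvd g"

end

theory Submission
  imports Defs "HOL-Library.Poly_Mapping"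
begin

unbundle fps_syntax

text \<open>
  Write \<open>dlog a = da / a\<close>. The residue is continuous and the substitution is given by convergent sums,
  so it is enough to treat a monomial \<open>h = u\<^sup>i v\<^sup>j\<close>: the residue of \<open>f\<^sup>i g\<^sup>j df \<and> dg\<close> has to be \<open>1\<close> if
  \<open>i = j = -1\<close> and \<open>0\<close> otherwise (\<open>residue2_monomial\<close>). Continuity enters through
  \<open>residue2_subst1_mult\<close> for the sum over \<open>i\<close>, while the sum over \<open>j\<close> is finite in each degree
  (\<open>residue2_change_of_vars_form\<close>).

  For \<open>i = j = -1\<close> a direct computation with \<open>g = y q\<close> reduces the residue of \<open>dlog f \<and> dlog g\<close> to the
  order of \<open>f(x,0)\<close>, which is \<open>1\<close> (\<open>residue2_dlog_dlog\<close>).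

  In the other cases the form is \<open>E\<^sup>n K\<^sup>m dlog E \<and> dlog K\<close>, up to sign, with \<open>E\<close> and \<open>K\<close> nonzero in
  \<open>k((x))((y))\<close> and natural numbers \<open>n\<close>, \<open>m\<close> not both zero. If \<open>n\<close> is not zero, then \<open>n\<close> times this form
  is exact and has residue \<open>0\<close> (\<open>of_nat_mult_residue2_dlog\<close>); otherwise \<open>E\<close> and \<open>K\<close> exchange roles. In
  characteristic zero this settles the matter. In characteristic \<open>p\<close> the form itself need not be
  exact, and the residue vanishes for arithmetic reasons: it is the reduction of the same expression
  over a ring without additive torsion. Such a ring is the monoid ring over the integers of the
  multiplicative monoid of \<open>k\<close> (\<open>unit_lifting_evaluate\<close>). It maps onto \<open>k\<close>, and nonzero Laurent series
  over \<open>k\<close> lift to invertible ones, so negative powers lift too. Over this ring \<open>n\<close> can be cancelled,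
  and the vanishing descends to \<open>k\<close> (\<open>residue2_dlog_transfer\<close>).
\<close>

section \<open>Coefficientwise operations on Laurent series\<close>

lemma fls_times_nth_bounds:
  fixes f g :: "'a::comm_ring_1 fls"
  assumes "\<And>i. i < a \<Longrightarrow> f $$ i = 0" "\<And>i. i < b \<Longrightarrow> g $$ i = 0"
  shows "(f * g) $$ n = (\<Sum>i=a..n-b. f $$ i * g $$ (n - i))"
proof -
  let ?S = "{min a (fls_subdegree f)..max (n - b) (n - fls_subdegree g)}"
  have "(f * g) $$ n = (\<Sum>i\<in>?S. f $$ i * g $$ (n - i))"
    unfolding fls_times_nth(2) by (rule sum.mono_neutral_left) (auto simp: not_le)
  also have "\<dots> = (\<Sum>i=a..n-b. f $$ i * g $$ (n - i))"
    by (rule sum.mono_neutral_right) (auto simp: not_le assms)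
  finally show ?thesis .
qed

definition fls_map :: "('a::zero \<Rightarrow> 'b::zero) \<Rightarrow> 'a fls \<Rightarrow> 'b fls" where
  "fls_map \<phi> f = Abs_fls (\<lambda>n. \<phi> (f $$ n))"

lemma fls_map_nth [simp]: "\<phi> 0 = 0 \<Longrightarrow> fls_map \<phi> f $$ n = \<phi> (f $$ n)"
  unfolding fls_map_def
  by (rule nth_Abs_fls_lower_bound[where N = "fls_subdegree f"]) simp

section \<open>The Jacobian on doubly iterated Laurent series\<close>

definition fls_deriv_x :: "'a::comm_ring_1 fls fls \<Rightarrow> 'a fls fls" where
  "fls_deriv_x = fls_map fls_deriv"

definition jac :: "'a::comm_ring_1 fls fls \<Rightarrow> 'a fls fls \<Rightarrow> 'a fls fls" where
  "jac A B = fls_deriv_x A * fls_deriv B - fls_deriv A * fls_deriv_x B"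

lemma fls_deriv_x_nth [simp]: "fls_deriv_x A $$ n = fls_deriv (A $$ n)"
  by (simp add: fls_deriv_x_def)

lemma fls_deriv_x_one: "fls_deriv_x 1 = 0"
  by (rule fls_eqI) simp

lemma fls_deriv_x_mult: "fls_deriv_x (A * B) = fls_deriv_x A * B + A * fls_deriv_x B"
proof (rule fls_eqI)
  fix n
  note b = fls_times_nth_bounds[of "fls_subdegree A" _ "fls_subdegree B" _ n]
  show "fls_deriv_x (A * B) $$ n = (fls_deriv_x A * B + A * fls_deriv_x B) $$ n"
    by (simp add: b fls_deriv_sum sum.distrib)
qed

lemma fls_deriv_commute: "fls_deriv (fls_deriv_x A) = fls_deriv_x (fls_deriv A)"
  by (rule fls_eqI) (simp del: of_int_add)

lemma residue2_fls_deriv_x: "residue2 (fls_deriv_x A) = 0"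
  by (simp add: residue2_def)

lemma residue2_fls_deriv: "residue2 (fls_deriv A) = 0"
  by (simp add: residue2_def)

lemma residue2_add: "residue2 (A + B) = residue2 A + residue2 B"
  by (simp add: residue2_def)

lemma residue2_diff: "residue2 (A - B) = residue2 A - residue2 B" for A :: "'a::ab_group_add fls fls"
  by (simp add: residue2_def)

lemma residue2_of_nat_mult: "residue2 (of_nat n * A) = of_nat n * residue2 A"
  for A :: "'a::comm_ring_1 fls fls"
  by (induction n) (simp_all add: algebra_simps residue2_add, simp add: residue2_def)

text \<open>
  Jacobians are exact: \<open>A\<^sub>x B\<^sub>y - A\<^sub>y B\<^sub>x = (A B\<^sub>y)\<^sub>x - (A B\<^sub>x)\<^sub>y\<close>, and a derivative with respect to a
  variable has no term with exponent \<open>-1\<close> in that variable.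
\<close>

lemma residue2_jac: "residue2 (jac A B) = 0"
proof -
  have "jac A B = fls_deriv_x (A * fls_deriv B) - fls_deriv (A * fls_deriv_x B)"
    by (simp add: jac_def fls_deriv_x_mult fls_deriv_commute algebra_simps)
  thus ?thesis by (simp only: residue2_diff residue2_fls_deriv_x residue2_fls_deriv diff_zero)
qed

lemma jac_mult_left: "jac (A * B) C = A * jac B C + B * jac A C"
  by (simp add: jac_def fls_deriv_x_mult algebra_simps)

lemma jac_self: "jac A A = 0"
  by (simp add: jac_def algebra_simps)

lemma jac_swap: "jac A B = - jac B A"
  by (simp add: jac_def algebra_simps)

lemma jac_one_left: "jac 1 A = 0"
  by (simp add: jac_def fls_deriv_x_one)

lemma jac_power_left: "A * jac (A ^ n) B = of_nat n * A ^ n * jac A B"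
  by (induction n) (simp_all add: jac_one_left jac_mult_left algebra_simps)

lemma jac_power_self: "jac (A ^ n) A = 0"
  by (induction n) (simp_all add: jac_one_left jac_mult_left jac_self)

lemma jac_inverse_self:
  assumes "A * A' = 1" shows "jac A' A = 0"
proof -
  have "0 = A' * jac (A * A') A" by (simp add: assms jac_one_left)
  also have "\<dots> = (A * A') * jac A' A" by (simp add: jac_mult_left jac_self algebra_simps)
  finally show ?thesis by (simp add: assms)
qed

text \<open>
  Here \<open>E'\<close> and \<open>K'\<close> are the inverses, so the form is \<open>E\<^sup>n K\<^sup>m dlog E \<and> dlog K\<close>. Multiplied by \<open>n\<close> it
  becomes \<open>d(E\<^sup>n) \<and> K\<^sup>m dlog K\<close>, which is the Jacobian of \<open>E\<^sup>n K\<^sup>m K'\<close> and \<open>K\<close>, because powers of \<open>K\<close> and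
  its inverse have zero Jacobian with \<open>K\<close>. The factor \<open>n\<close> can be cancelled when the coefficient ring
  has no additive torsion, but not in characteristic \<open>p\<close> when \<open>p\<close> divides \<open>n\<close>.
\<close>

lemma of_nat_mult_residue2_dlog:
  assumes E: "E * E' = 1" and K: "K * K' = 1"
  shows "of_nat n * residue2 (E ^ n * K ^ m * (E' * K' * jac E K)) = 0"
proof -
  have 1: "jac (E ^ n) K = of_nat n * (E ^ n * E' * jac E K)"
  proof -
    have "jac (E ^ n) K = (E * E') * jac (E ^ n) K" by (simp add: E)
    also have "\<dots> = E' * (E * jac (E ^ n) K)" by (simp add: mult_ac)
    finally show ?thesis by (simp add: jac_power_left mult_ac)
  qed
  have "jac (E ^ n * (K ^ m * K')) K = (K ^ m * K') * jac (E ^ n) K"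
    by (simp add: jac_mult_left jac_power_self jac_inverse_self[OF K])
  also have "\<dots> = of_nat n * (E ^ n * K ^ m * (E' * K' * jac E K))"
    by (simp add: 1 mult_ac)
  finally have "residue2 (of_nat n * (E ^ n * K ^ m * (E' * K' * jac E K))) = 0"
    by (metis residue2_jac)
  thus ?thesis by (simp add: residue2_of_nat_mult)
qed

section \<open>Transfer along a ring homomorphism\<close>

locale unital_ring_hom =
  fixes \<phi> :: "'a::comm_ring_1 \<Rightarrow> 'b::comm_ring_1"
  assumes add: "\<phi> (x + y) = \<phi> x + \<phi> y"
    and mult: "\<phi> (x * y) = \<phi> x * \<phi> y"
    and one: "\<phi> 1 = 1"
begin

lemma zero [simp]: "\<phi> 0 = 0"
  using add[of 0 0] by simp

lemma uminus: "\<phi> (- x) = - \<phi> x"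
  using add[of x "-x"] by (simp add: eq_neg_iff_add_eq_0 add.commute)

lemma diff: "\<phi> (x - y) = \<phi> x - \<phi> y"
  using add[of x "- y"] by (simp add: uminus)

lemma sum: "\<phi> (sum h A) = (\<Sum>a\<in>A. \<phi> (h a))"
  by (induction A rule: infinite_finite_induct) (simp_all add: add)

lemma power: "\<phi> (x ^ n) = \<phi> x ^ n"
  by (induction n) (simp_all add: one mult)

lemma of_nat: "\<phi> (of_nat n) = of_nat n"
  by (induction n) (simp_all add: one add)

lemma of_int: "\<phi> (of_int n) = of_int n"
  by (cases n) (simp_all add: uminus of_nat one add diff)

lemma unital_ring_hom_fls_map: "unital_ring_hom (fls_map \<phi>)"
proof
  fix x y :: "'a fls"
  show "fls_map \<phi> (x + y) = fls_map \<phi> x + fls_map \<phi> y"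
    by (rule fls_eqI) (simp add: add)
  show "fls_map \<phi> (x * y) = fls_map \<phi> x * fls_map \<phi> y"
  proof (rule fls_eqI)
    fix n
    note b = fls_times_nth_bounds[of "fls_subdegree x" _ "fls_subdegree y" _ n]
    show "fls_map \<phi> (x * y) $$ n = (fls_map \<phi> x * fls_map \<phi> y) $$ n"
      by (simp add: b sum mult)
  qed
  show "fls_map \<phi> 1 = 1"
    by (rule fls_eqI) (simp add: one)
qed

lemma fls_deriv_fls_map: "fls_deriv (fls_map \<phi> f) = fls_map \<phi> (fls_deriv f)"
  by (rule fls_eqI) (simp add: mult of_int add one)

end

lemma unit_inverse_unique:
  fixes a :: "'a::comm_ring_1"
  assumes "a * b = 1" "a * c = 1"
  shows "b = c"
proof -
  have "b = (a * c) * b" by (simp add: assms)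
  also have "\<dots> = (a * b) * c" by (simp add: mult_ac)
  finally show ?thesis by (simp add: assms)
qed

text \<open>
  The section \<open>s\<close> is in general neither additive nor multiplicative. The conditions are chosen so
  that they pass from \<open>\<phi>\<close> and \<open>s\<close> to the induced maps on Laurent series, where an element with
  invertible leading coefficient is invertible; applied twice, this lifts every nonzero element of
  \<open>k((x))((y))\<close> to a unit.
\<close>

locale unit_lifting = unital_ring_hom \<phi>
  for \<phi> :: "'a::comm_ring_1 \<Rightarrow> 'b::comm_ring_1" +
  fixes s :: "'b \<Rightarrow> 'a"
  assumes s_right_inverse: "\<phi> (s b) = b"
    and s_zero [simp]: "s 0 = 0"
    and s_unit: "b \<noteq> 0 \<Longrightarrow> \<exists>u. s b * u = 1"
begin

lemma s_eq_0_iff: "s b = 0 \<longleftrightarrow> b = 0"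
  using s_right_inverse[of b] by auto

lemma unit_lifting_fls_map: "unit_lifting (fls_map \<phi>) (fls_map s)"
proof -
  interpret fls: unital_ring_hom "fls_map \<phi>" by (rule unital_ring_hom_fls_map)
  show ?thesis
  proof
    fix f :: "'b fls"
    show "fls_map \<phi> (fls_map s f) = f"
      by (rule fls_eqI) (simp add: s_right_inverse)
    show "fls_map s (0 :: 'b fls) = 0"
      by (rule fls_eqI) simp
    assume "f \<noteq> 0"
    hence "fls_map s f $$ fls_subdegree f \<noteq> 0"
      by (simp add: s_eq_0_iff)
    hence deg: "fls_subdegree (fls_map s f) = fls_subdegree f"
      by (rule fls_subdegree_eqI) simp
    obtain u where "s (f $$ fls_subdegree f) * u = 1"
      using s_unit \<open>f \<noteq> 0\<close> by (meson nth_fls_subdegree_nonzero)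
    thus "\<exists>u. fls_map s f * u = 1"
      using fls_right_inverse[of "fls_map s f" u] by (auto simp: deg)
  qed
qed

text \<open>
  Everything in the residue of \<open>E\<^sup>n K\<^sup>m dlog E \<and> dlog K\<close> commutes with coefficientwise application of
  \<open>\<phi>\<close>, so the residue is the image of the same residue formed with lifts of \<open>E\<close> and \<open>K\<close>. Upstairs the
  factor \<open>n\<close> can be cancelled.
\<close>

lemma residue2_dlog_transfer:
  assumes torsion_free: "\<And>n (r::'a). 0 < n \<Longrightarrow> of_nat n * r = 0 \<Longrightarrow> r = 0"
    and EE: "E * E' = 1" and KK: "K * K' = 1" and nz: "E \<noteq> 0" "K \<noteq> 0" and n: "0 < n"
  shows "residue2 (E ^ n * K ^ m * (E' * K' * jac E K)) = (0::'b)"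
proof -
  interpret L1: unit_lifting "fls_map \<phi>" "fls_map s" by (rule unit_lifting_fls_map)
  interpret L2: unit_lifting "fls_map (fls_map \<phi>)" "fls_map (fls_map s)"
    by (rule L1.unit_lifting_fls_map)
  let ?P = "fls_map (fls_map \<phi>)" and ?S = "fls_map (fls_map s)"
  obtain A where A: "?S E * A = 1" using L2.s_unit nz(1) by blast
  obtain B where B: "?S K * B = 1" using L2.s_unit nz(2) by blast
  have "E * ?P A = 1" using L2.mult[of "?S E" A] by (simp add: A L2.one L2.s_right_inverse)
  hence PA: "?P A = E'" using EE by (rule unit_inverse_unique)
  have "K * ?P B = 1" using L2.mult[of "?S K" B] by (simp add: B L2.one L2.s_right_inverse)
  hence PB: "?P B = K'" using KK by (rule unit_inverse_unique)
  have fls_deriv_x: "?P (fls_deriv_x Z) = fls_deriv_x (?P Z)" for Z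
    by (rule fls_eqI) (simp add: fls_deriv_fls_map)
  have jac: "?P (jac Y Z) = jac (?P Y) (?P Z)" for Y Z
    by (simp add: jac_def L2.diff L2.mult fls_deriv_x L1.fls_deriv_fls_map)
  define W where "W = ?S E ^ n * ?S K ^ m * (A * B * jac (?S E) (?S K))"
  have "residue2 W = 0"
    using torsion_free[OF n of_nat_mult_residue2_dlog[OF A B]] by (simp add: W_def)
  moreover have "?P W = E ^ n * K ^ m * (E' * K' * jac E K)"
    by (simp add: W_def L2.mult L2.power jac PA PB L2.s_right_inverse)
  moreover have "residue2 (?P W) = \<phi> (residue2 W)"
    by (simp add: residue2_def)
  ultimately show ?thesis by simp
qed

end

section \<open>A torsion-free ring over a given field\<close>

text \<open>
  The monoid ring \<open>\<int>[(k, \<cdot>)]\<close> is free as an abelian group, maps onto \<open>k\<close> by evaluating formal sums, and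
  contains a unit over every nonzero element of \<open>k\<close>. As finitely supported functions multiply by
  convolution over an additive monoid, the multiplication of \<open>k\<close> is written additively on a copy.
\<close>

datatype 'a multiplicative = Mult (base: 'a)

instantiation multiplicative :: (comm_monoid_mult) comm_monoid_add
begin
definition "0 = Mult 1"
definition "a + b = Mult (base a * base b)"
instance
  by standard (simp_all add: zero_multiplicative_def plus_multiplicative_def mult_ac)
end

definition evaluate :: "('k::comm_ring_1 multiplicative \<Rightarrow>\<^sub>0 int) \<Rightarrow> 'k" where
  "evaluate p = (\<Sum>a\<in>Poly_Mapping.keys p. of_int (poly_mapping.lookup p a) * base a)"

text \<open>
  Zero is sent to the zero of the ring rather than to the monomial of \<open>0\<close>, so that applying this
  map to the coefficients of a Laurent series yields a Laurent series again.
\<close>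

definition monomial_lift :: "'k::comm_ring_1 \<Rightarrow> ('k multiplicative \<Rightarrow>\<^sub>0 int)" where
  "monomial_lift b = (if b = 0 then 0 else Poly_Mapping.single (Mult b) 1)"

lemma evaluate_superset:
  assumes "finite S" "Poly_Mapping.keys p \<subseteq> S"
  shows "evaluate p = (\<Sum>a\<in>S. of_int (poly_mapping.lookup p a) * base a)"
  unfolding evaluate_def using assms
  by (intro sum.mono_neutral_left) (auto simp: in_keys_iff)

lemma evaluate_add: "evaluate (p + q) = evaluate p + evaluate q"
proof -
  have "Poly_Mapping.keys (p + q) \<subseteq> Poly_Mapping.keys p \<union> Poly_Mapping.keys q"
    by (rule Poly_Mapping.keys_add)
  thus ?thesis
    by (simp add: evaluate_superset[of "Poly_Mapping.keys p \<union> Poly_Mapping.keys q"]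
        lookup_add sum.distrib algebra_simps)
qed

lemma evaluate_single: "evaluate (Poly_Mapping.single a n) = of_int n * base a"
  by (simp add: evaluate_superset[of "{a}"])

lemma evaluate_diff: "evaluate (p - q) = evaluate p - evaluate q"
  using evaluate_add[of "p - q" q] by (simp add: algebra_simps)

lemma evaluate_zero: "evaluate 0 = 0"
  by (simp add: evaluate_def)

lemma evaluate_mult: "evaluate (p * q) = evaluate p * evaluate q"
proof (rule frag_induction[OF subset_UNIV,
      where P = "\<lambda>p. evaluate (p * q) = evaluate p * evaluate q"])
  fix a :: "'a multiplicative"
  show "evaluate (frag_of a * q) = evaluate (frag_of a) * evaluate q"
    by (rule frag_induction[OF subset_UNIV,
          where P = "\<lambda>q. evaluate (frag_of a * q) = evaluate (frag_of a) * evaluate q"])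
       (simp_all add: evaluate_zero mult_single evaluate_single evaluate_diff
          plus_multiplicative_def right_diff_distrib)
qed (simp_all add: evaluate_zero evaluate_diff left_diff_distrib)

lemma unit_lifting_evaluate: "unit_lifting evaluate (monomial_lift :: 'k::field \<Rightarrow> _)"
proof
  show "evaluate (1 :: 'k multiplicative \<Rightarrow>\<^sub>0 int) = 1"
    by (simp add: evaluate_single zero_multiplicative_def flip: single_one)
  fix b :: 'k
  show "evaluate (monomial_lift b) = b"
    by (simp add: monomial_lift_def evaluate_zero evaluate_single)
  assume "b \<noteq> 0"
  hence "monomial_lift b * monomial_lift (inverse b) = 1"
    by (simp add: monomial_lift_def mult_single plus_multiplicative_def flip: single_one)
       (simp add: zero_multiplicative_def)
  thus "\<exists>u. monomial_lift b * u = 1" by blast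
qed (simp_all add: evaluate_add evaluate_mult monomial_lift_def)

lemma frag_torsion_free:
  fixes r :: "'k::comm_monoid_add \<Rightarrow>\<^sub>0 int"
  assumes "0 < n" "of_nat n * r = 0"
  shows "r = 0"
proof (rule poly_mapping_eqI)
  fix k
  have "poly_mapping.lookup (of_nat m * r) k = int m * poly_mapping.lookup r k" for m
    by (induction m) (simp_all add: lookup_add algebra_simps)
  from this[of n] assms show "poly_mapping.lookup r k = poly_mapping.lookup 0 k" by simp
qed

section \<open>Residues of monomial forms\<close>

lemma jac_inverse_left:
  assumes "E \<noteq> (0::'k::field fls fls)"
  shows "E * jac (inverse E) K = - inverse E * jac E K"
proof -
  have "0 = jac (E * inverse E) K" using assms by (simp add: jac_one_left)
  thus ?thesis by (simp add: jac_mult_left eq_neg_iff_add_eq_0)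
qed

lemma residue2_dlog_nat:
  fixes E K :: "'k::field fls fls"
  assumes nz: "E \<noteq> 0" "K \<noteq> 0" and nm: "n \<noteq> 0 \<or> m \<noteq> 0"
  shows "residue2 (E ^ n * K ^ m * (inverse E * inverse K * jac E K)) = 0"
proof -
  interpret unit_lifting evaluate "monomial_lift :: 'k \<Rightarrow> _" by (rule unit_lifting_evaluate)
  have *: "residue2 (E ^ n * K ^ m * (inverse E * inverse K * jac E K)) = 0"
    if "n > 0" "E \<noteq> 0" "K \<noteq> 0" for E K :: "'k fls fls" and n m
    by (rule residue2_dlog_transfer[OF frag_torsion_free]) (use that in auto)
  show ?thesis
  proof (cases "n = 0")
    case False
    thus ?thesis using * nz by simp
  next
    case True
    hence "m > 0" using nm by simp
    from *[OF this nz(2) nz(1), of n] show ?thesis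
      by (subst jac_swap) (simp add: mult_ac residue2_def)
  qed
qed

text \<open>
  Since \<open>dlog\<close> of an inverse is the negative of \<open>dlog\<close>, a negative power of \<open>E\<close> can be replaced by a
  positive power of the inverse of \<open>E\<close> at the cost of the sign \<open>e\<close>.
\<close>

lemma powi_dlog_cases:
  fixes E :: "'k::field fls fls"
  assumes "E \<noteq> 0"
  obtains B n e where "B \<noteq> 0" "n = 0 \<longleftrightarrow> i = 0" "e = 1 \<or> e = -1"
    "\<forall>K. E powi i * (inverse E * jac E K) = e * (B ^ n * (inverse B * jac B K))"
proof (cases "i \<ge> 0")
  case True
  thus ?thesis using assms by (intro that[of E "nat i" 1]) (auto simp: power_int_def)
next
  case False
  have "E powi i * (inverse E * jac E K) =
    -1 * (inverse E ^ nat (-i) * (inverse (inverse E) * jac (inverse E) K))" for K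
    using False assms by (simp add: jac_inverse_left power_int_def)
  thus ?thesis using assms False by (intro that[of "inverse E" "nat (-i)" "-1"]) auto
qed

lemma residue2_dlog:
  fixes E K :: "'k::field fls fls"
  assumes nz: "E \<noteq> 0" "K \<noteq> 0" and ij: "i \<noteq> 0 \<or> j \<noteq> 0"
  shows "residue2 (E powi i * K powi j * (inverse E * inverse K * jac E K)) = 0"
proof -
  obtain B n e where B: "B \<noteq> 0" "n = 0 \<longleftrightarrow> i = 0" "e = 1 \<or> e = -1"
    "\<forall>K. E powi i * (inverse E * jac E K) = e * (B ^ n * (inverse B * jac B K))"
    by (rule powi_dlog_cases[OF nz(1), where i = i]) (rule that)
  obtain C m d where C: "C \<noteq> 0" "m = 0 \<longleftrightarrow> j = 0" "d = 1 \<or> d = -1"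
    "\<forall>E. K powi j * (inverse K * jac K E) = d * (C ^ m * (inverse C * jac C E))"
    by (rule powi_dlog_cases[OF nz(2), where i = j]) (rule that)
  have "E powi i * K powi j * (inverse E * inverse K * jac E K)
      = K powi j * inverse K * (E powi i * (inverse E * jac E K))" by simp
  also have "\<dots> = - (e * B ^ n * inverse B) * (K powi j * (inverse K * jac K B))"
    by (simp add: B(4)[rule_format] jac_swap[of B K])
  also have "\<dots> = (e * d) * (B ^ n * C ^ m * (inverse B * inverse C * jac B C))"
    by (simp add: C(4)[rule_format] jac_swap[of B C])
  finally show ?thesis
    using residue2_dlog_nat[OF B(1) C(1), of n m] ij B(2,3) C(2,3)
    by (auto simp: residue2_def)
qed

lemma fls_deriv_x_fps_to_fls: "fls_deriv_x (fps_to_fls f) = fps_to_fls (deriv_x f)"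
  by (rule fls_eqI) (simp add: deriv_x_def)

lemma jac_fps_to_fls: "jac (fps_to_fls f) (fps_to_fls g) = fps_to_fls (jacobian f g)"
  by (simp add: jac_def jacobian_def deriv_y_def fls_deriv_x_fps_to_fls fls_deriv_fps_to_fls
      fls_times_fps_to_fls)

text \<open>
  With \<open>g = y q\<close> one has \<open>dlog g = dlog y + dlog q\<close>. The part with \<open>dlog q\<close> has no pole in \<open>y\<close> as \<open>f\<close> and
  \<open>q\<close> are units of \<open>k((x))[[y]]\<close>. The part \<open>dlog f \<and> dlog y\<close> contributes the residue in \<open>x\<close> of
  \<open>dlog f(x,0)\<close>, which is the order of \<open>f(x,0)\<close>.
\<close>

lemma residue2_dlog_dlog:
  fixes f g :: "'k::field fls fps"
  assumes f: "fls_subdegree (fps_nth f 0) = 1" and g: "g = fps_X * q" "fps_nth q 0 \<noteq> 0"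
  defines "F \<equiv> fps_to_fls f" and "G \<equiv> fps_to_fls g"
  shows "residue2 (inverse F * inverse G * jac F G) = 1"
proof -
  define Q where "Q = fps_to_fls q"
  have f0: "fps_nth f 0 \<noteq> 0" using f by auto
  have nz: "F \<noteq> 0" "Q \<noteq> 0" using f0 g(2) by (auto simp: F_def Q_def)
  have inv: "inverse F = fps_to_fls (inverse f)" "inverse Q = fps_to_fls (inverse q)"
    using f0 g(2) by (simp_all add: F_def Q_def fls_inverse_fps_to_fls subdegree_eq_0)
  have G: "G = fls_X * Q" by (simp add: G_def g(1) Q_def fls_times_fps_to_fls)
  have "jac F G = - jac (fls_X * Q) F" by (simp add: G jac_swap[of F])
  also have "\<dots> = fls_X * jac F Q + Q * fls_deriv_x F"
  proof -
    have "fls_deriv_x fls_X = (0 :: 'k fls fls)" by (rule fls_eqI) simp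
    hence "jac fls_X F = - fls_deriv_x F" by (simp add: jac_def)
    thus ?thesis by (simp add: jac_mult_left jac_swap[of Q F])
  qed
  finally have jac_FG: "jac F G = fls_X * jac F Q + Q * fls_deriv_x F" .
  have "inverse F * inverse G * jac F G
      = inverse F * inverse Q * jac F Q + fls_X_inv * (inverse F * fls_deriv_x F)"
  proof -
    have "inverse G = inverse Q * fls_X_inv" by (simp add: G fls_inverse_X)
    moreover have "fls_X_inv * fls_X = (1 :: 'k fls fls)"
      by (simp add: fls_inverse_X[symmetric])
    moreover have "inverse F * (inverse Q * U) * (V * jac F Q + Q * fls_deriv_x F)
        = (U * V) * (inverse F * inverse Q * jac F Q)
          + (inverse Q * Q) * (U * (inverse F * fls_deriv_x F))" for U V
      by (simp add: distrib_left mult_ac)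
    ultimately show ?thesis using nz by (simp add: jac_FG)
  qed
  also have "\<dots> = fps_to_fls (inverse f * inverse q * jacobian f q)
      + fls_X_inv * fps_to_fls (inverse f * deriv_x f)"
    unfolding inv by (simp only: F_def Q_def jac_fps_to_fls fls_deriv_x_fps_to_fls fls_times_fps_to_fls)
  finally show ?thesis
    using fls_residue_deriv_times_inverse_eq_subdegree(2)[of "fps_nth f 0"] f
    by (simp add: residue2_def fls_X_inv_times_conv_shift deriv_x_def)
qed

section \<open>Convergence of the substitution\<close>

lemma fls_mult_nth_eq_0:
  fixes f g :: "'a::comm_ring_1 fls"
  assumes "\<And>i. i < a \<Longrightarrow> f $$ i = 0" "\<And>i. i < b \<Longrightarrow> g $$ i = 0" "n < a + b"
  shows "(f * g) $$ n = 0"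
  using assms(3) by (subst fls_times_nth_bounds[of a f b g]) (auto intro: assms)

text \<open>
  The hypothesis says that the summands tend to zero: for every \<open>m\<close>, all but finitely many have order
  greater than \<open>m\<close>. The metric only sees the order of a difference, so the series of the
  coefficientwise sums is the limit.
\<close>

lemma fls_infsum_nth:
  fixes S :: "'i \<Rightarrow> 'k::ab_group_add fls"
  assumes fin: "\<And>m. finite {i. \<exists>l\<le>m. S i $$ l \<noteq> 0}"
    and I: "finite I" "{i. S i $$ m \<noteq> 0} \<subseteq> I"
  shows "infsum S UNIV $$ m = (\<Sum>i\<in>I. S i $$ m)"
proof -
  define J where "J = (\<lambda>m. {i. \<exists>l\<le>m. S i $$ l \<noteq> 0})"
  have finJ: "finite (J m)" for m using fin by (simp add: J_def)
  \<comment> \<open>In negative degrees only the finitely many summands indexed by \<open>J (-1)\<close> contribute, and \<open>N\<close>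
    bounds their orders from below; hence the sums form a Laurent series.\<close>
  define L where "L = Abs_fls (\<lambda>m. \<Sum>i\<in>J m. S i $$ m)"
  define N where "N = Min (insert 0 ((\<lambda>i. fls_subdegree (S i)) ` J (-1)))"
  have L: "L $$ m = (\<Sum>i\<in>J m. S i $$ m)" for m
    unfolding L_def
  proof (rule nth_Abs_fls_lower_bound[where N = N], intro allI impI sum.neutral ballI)
    fix m i assume m: "m < N" and i: "i \<in> J m"
    have "N \<le> 0" by (simp add: N_def finJ)
    hence "m \<le> -1" using m by simp
    hence "i \<in> J (-1)" using i by (auto simp: J_def intro: order.trans)
    hence "N \<le> fls_subdegree (S i)" by (simp add: N_def finJ)
    thus "S i $$ m = 0" using m by simp
  qed
  have L_eq: "L $$ m = (\<Sum>i\<in>I. S i $$ m)" if "finite I" "{i. S i $$ m \<noteq> 0} \<subseteq> I" for m I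
    unfolding L by (rule sum.mono_neutral_cong) (use that finJ in \<open>auto simp: J_def\<close>)
  have "(S has_sum L) UNIV"
    unfolding has_sum_def tendsto_iff eventually_finite_subsets_at_top
  proof (intro allI impI)
    fix e :: real assume "e > 0"
    then obtain M where M: "inverse (2 ^ M) < e"
      using real_arch_pow_inv[of e "1/2"] by (auto simp: power_one_over inverse_eq_divide)
    have "dist (sum S Y) L < e" if Y: "finite Y" "J (int M) \<subseteq> Y" for Y
    proof (cases "sum S Y = L")
      case False
      have "(sum S Y - L) $$ l = 0" if "l \<le> int M" for l
        using L_eq[of Y l] Y that by (fastforce simp: fls_nth_sum J_def)
      hence "int M \<le> fls_subdegree (sum S Y - L)"
        using False by (intro fls_subdegree_geI) auto
      hence "dist (sum S Y) L \<le> inverse (2 ^ M)"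
        using False by (auto simp: dist_fls_def intro!: power_increasing)
      thus ?thesis using M by simp
    qed (use \<open>e > 0\<close> in simp)
    thus "\<exists>X. finite X \<and> X \<subseteq> UNIV \<and>
       (\<forall>Y. finite Y \<and> X \<subseteq> Y \<and> Y \<subseteq> UNIV \<longrightarrow> dist (sum S Y) L < e)"
      using finJ[of "int M"] by blast
  qed
  thus ?thesis using L_eq[OF I] by (simp add: infsumI)
qed

text \<open>
  On the coefficients of \<open>y\<^sup>l\<close> with \<open>l \<le> n\<close>, the order in \<open>x\<close> can drop at most linearly in \<open>l\<close>: for some
  \<open>C\<close> it is at least \<open>1 - C l\<close> for \<open>f\<close>, hence at least \<open>i - C l\<close> for the \<open>i\<close>-th power of \<open>f\<close>.
\<close>

lemma fps_power_decay:
  fixes f :: "'k::field fls fps"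
  assumes f: "fls_subdegree (fps_nth f 0) = 1"
  shows "\<exists>N\<ge>0. \<forall>i\<ge>N. \<forall>l\<le>n. \<forall>r\<le>m. (fps_to_fls f powi i) $$ l $$ r = 0"
proof -
  define C where "C = (\<Sum>l\<le>nat n. \<bar>1 - fls_subdegree (fps_nth f l)\<bar>)"
  have C0: "C \<ge> 0" by (simp add: C_def sum_nonneg)
  have base: "fps_nth f l $$ r = 0" if "l \<le> nat n" "r < 1 - C * int l" for l r
  proof (cases "l = 0")
    case True
    thus ?thesis using that f by simp
  next
    case False
    have "\<bar>1 - fls_subdegree (fps_nth f l)\<bar> \<le> C"
      unfolding C_def using that by (intro member_le_sum) auto
    moreover have "C \<le> C * int l" using False C0 by (simp add: mult_le_cancel_left1)
    ultimately show ?thesis using that by simp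
  qed
  have pow: "\<forall>l\<le>nat n. \<forall>r < int i - C * int l. fps_nth (f ^ i) l $$ r = 0" for i
  proof (induction i)
    case 0
    show ?case
    proof (intro allI impI)
      fix l r assume "r < int 0 - C * int l"
      thus "fps_nth (f ^ 0) l $$ r = 0" using C0 by (cases "l = 0") auto
    qed
  next
    case (Suc i)
    show ?case
    proof (intro allI impI)
      fix l r assume l: "l \<le> nat n" and r: "r < int (Suc i) - C * int l"
      have "(fps_nth f a * fps_nth (f ^ i) (l - a)) $$ r = 0" if "a \<le> l" for a
      proof (rule fls_mult_nth_eq_0)
        show "r < (1 - C * int a) + (int i - C * int (l - a))"
          using r that by (simp add: of_nat_diff algebra_simps)
      qed (use that l base Suc in auto)
      thus "fps_nth (f ^ Suc i) l $$ r = 0"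
        by (simp add: fps_mult_nth fls_nth_sum)
    qed
  qed
  define N where "N = \<bar>m\<bar> + C * \<bar>n\<bar> + 1"
  have "N \<ge> 0" using mult_nonneg_nonneg[OF C0 abs_ge_zero[of n]] by (simp add: N_def)
  have "(fps_to_fls f powi i) $$ l $$ r = 0" if "i \<ge> N" "l \<le> n" "r \<le> m" for i l r
  proof (cases "l < 0")
    case False
    have "i \<ge> 0" using that(1) \<open>N \<ge> 0\<close> by simp
    hence "fps_to_fls f powi i = fps_to_fls (f ^ nat i)"
      by (simp add: power_int_def fps_to_fls_power)
    moreover have "C * l \<le> C * \<bar>n\<bar>" using C0 False that by (intro mult_left_mono) auto
    hence "r < i - C * l" using that by (simp add: N_def)
    ultimately show ?thesis using pow[of "nat i"] False that \<open>i \<ge> 0\<close> by auto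
  next
    case True
    have "fls_subdegree (fps_to_fls f powi i) = 0"
      using f by (subst fls_subdegree_power_int) (auto simp: fls_subdegree_fls_to_fps)
    thus ?thesis using True fls_eq0_below_subdegree[of l "fps_to_fls f powi i"]
      by (simp only: fls_zero_nth)
  qed
  thus ?thesis using \<open>N \<ge> 0\<close> by blast
qed

text \<open>
  Multiplication by a fixed \<open>P\<close> followed by the residue is continuous on \<open>k((x))[[y]]\<close> for
  coefficientwise convergence: only finitely many pairs of coefficients of \<open>D\<close> and \<open>P\<close> with respect
  to \<open>y\<close> are multiplied, and each of these products involves only finitely many powers of \<open>x\<close>.
\<close>

lemma residue2_mult_continuous:
  fixes P :: "'k::field fls fls"
  shows "\<exists>n m. \<forall>D. (\<forall>l<0. D $$ l = 0) \<longrightarrow> (\<forall>l\<le>n. \<forall>r\<le>m. D $$ l $$ r = 0)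
           \<longrightarrow> residue2 (D * P) = 0"
proof -
  define n where "n = - 1 - fls_subdegree P"
  define m where "m = (\<Sum>l\<in>{0..n}. \<bar>fls_subdegree (P $$ (- 1 - l))\<bar>)"
  have "residue2 (D * P) = 0"
    if D: "\<forall>l<0. D $$ l = 0" "\<forall>l\<le>n. \<forall>r\<le>m. D $$ l $$ r = 0" for D
  proof -
    have "(D $$ l * P $$ (-1 - l)) $$ -1 = 0" if l: "l \<in> {0..n}" for l
    proof (rule fls_mult_nth_eq_0)
      have "\<bar>fls_subdegree (P $$ (- 1 - l))\<bar> \<le> m"
        unfolding m_def using l by (intro member_le_sum) auto
      thus "-1 < (m + 1) + fls_subdegree (P $$ (-1 - l))" by linarith
    qed (use l D in auto)
    moreover have "(D * P) $$ -1 = (\<Sum>l\<in>{0..n}. D $$ l * P $$ (-1 - l))"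
      unfolding n_def by (rule fls_times_nth_bounds) (use D in auto)
    ultimately show ?thesis by (simp add: residue2_def fls_nth_sum)
  qed
  thus ?thesis by blast
qed

definition subst1_term :: "'k::field fls fps \<Rightarrow> 'k fls \<Rightarrow> int \<Rightarrow> 'k fls fls" where
  "subst1_term f c i = fls_const (fls_const (c $$ i)) * fps_to_fls f powi i"

lemma subst1_term_nth: "subst1_term f c i $$ l $$ r = c $$ i * (fps_to_fls f powi i) $$ l $$ r"
  by (simp add: subst1_term_def)

lemma subst1_term_nth_neg:
  assumes "fps_nth f 0 \<noteq> 0" "l < 0"
  shows "subst1_term f c i $$ l = 0"
proof -
  have "fls_subdegree (fps_to_fls f powi i) = 0"
    using assms by (subst fls_subdegree_power_int) (simp add: fls_subdegree_fls_to_fps subdegree_eq_0)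
  hence "(fps_to_fls f powi i) $$ l = 0" 
    using assms(2) fls_eq0_below_subdegree[of l "fps_to_fls f powi i"] by (simp only:)
  thus ?thesis by (simp add: subst1_term_def)
qed

lemma subst1_nth_infsum:
  assumes "fps_nth f 0 \<noteq> 0"
  shows "subst1 f c $$ l = (\<Sum>\<^sub>\<infinity>i. subst1_term f c i $$ l)"
  unfolding subst1_def coeffwise_infsum_def subst1_term_def[symmetric]
  by (rule nth_Abs_fls_lower_bound[where N = 0]) (simp add: subst1_term_nth_neg[OF assms])

lemma subst1_nth_neg:
  assumes "fps_nth f 0 \<noteq> 0" "l < 0"
  shows "subst1 f c $$ l = 0"
  by (simp add: subst1_nth_infsum subst1_term_nth_neg assms)

lemma subst1_nth_nth:
  fixes f :: "'k::field fls fps"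
  assumes f: "fls_subdegree (fps_nth f 0) = 1"
    and I: "finite I" "{i. subst1_term f c i $$ l $$ r \<noteq> 0} \<subseteq> I"
  shows "subst1 f c $$ l $$ r = (\<Sum>i\<in>I. subst1_term f c i $$ l $$ r)"
proof -
  have "fps_nth f 0 \<noteq> 0" using f by auto
  moreover have "finite {i. \<exists>k\<le>m. subst1_term f c i $$ l $$ k \<noteq> 0}" for m
  proof -
    obtain N where N: "\<And>i k. i \<ge> N \<Longrightarrow> k \<le> m \<Longrightarrow> (fps_to_fls f powi i) $$ l $$ k = 0"
      using fps_power_decay[OF f, of l m] by blast
    have "{i. \<exists>k\<le>m. subst1_term f c i $$ l $$ k \<noteq> 0} \<subseteq> {fls_subdegree c..N}"
    proof (intro subsetI, elim CollectE exE conjE)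
      fix i k assume k: "k \<le> m" "subst1_term f c i $$ l $$ k \<noteq> 0"
      hence "c $$ i \<noteq> 0" "(fps_to_fls f powi i) $$ l $$ k \<noteq> 0"
        by (auto simp: subst1_term_nth)
      thus "i \<in> {fls_subdegree c..N}"
        using N[OF _ k(1), of i] by (cases "N \<le> i") (auto intro: fls_subdegree_leI)
    qed
    thus ?thesis by (rule finite_subset) simp
  qed
  ultimately show ?thesis
    by (simp add: subst1_nth_infsum fls_infsum_nth[OF _ I])
qed

text \<open>
  By continuity, truncating \<open>c(f)\<close> far enough does not change the residue of its product with \<open>P\<close>.
\<close>

lemma residue2_subst1_mult:
  fixes f :: "'k::field fls fps"
  assumes f: "fls_subdegree (fps_nth f 0) = 1"
  shows "\<exists>I. finite I \<and> -1 \<in> I \<and>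
     residue2 (subst1 f c * P) = (\<Sum>i\<in>I. c $$ i * residue2 (fps_to_fls f powi i * P))"
proof -
  have f0: "fps_nth f 0 \<noteq> 0" using f by auto
  obtain n m where cont: "\<forall>D. (\<forall>l<0. D $$ l = 0) \<longrightarrow> (\<forall>l\<le>n. \<forall>r\<le>m. D $$ l $$ r = 0)
           \<longrightarrow> residue2 (D * P) = 0"
    using residue2_mult_continuous[of P] by (elim exE)
  obtain N where N: "N \<ge> 0"
      "\<And>i l r. \<lbrakk>i \<ge> N; l \<le> n; r \<le> m\<rbrakk> \<Longrightarrow> (fps_to_fls f powi i) $$ l $$ r = 0"
    using fps_power_decay[OF f, of n m] by blast
  \<comment> \<open>The lower bound is at most \<open>-1\<close> so that the range contains \<open>-1\<close>, where the residue is read off.\<close>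
  define I where "I = {min (-1) (fls_subdegree c)..N}"
  define D where "D = subst1 f c - (\<Sum>i\<in>I. subst1_term f c i)"
  have "residue2 (D * P) = 0"
  proof (rule cont[rule_format])
    fix l :: int assume l: "l < 0"
    show "D $$ l = 0"
      by (simp add: D_def fls_nth_sum subst1_nth_neg[OF f0 l] subst1_term_nth_neg[OF f0 l])
  next
    fix l r assume lr: "l \<le> n" "r \<le> m"
    show "D $$ l $$ r = 0"
    proof -
      have "{i. subst1_term f c i $$ l $$ r \<noteq> 0} \<subseteq> I"
      proof (intro subsetI, elim CollectE)
        fix i assume "subst1_term f c i $$ l $$ r \<noteq> 0"
        hence "c $$ i \<noteq> 0" "(fps_to_fls f powi i) $$ l $$ r \<noteq> 0"
          by (auto simp: subst1_term_nth)
        thus "i \<in> I"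
          using N(2)[OF _ lr, of i] fls_subdegree_leI[of c i]
          by (cases "N \<le> i") (auto simp: I_def)
      qed
      hence "subst1 f c $$ l $$ r = (\<Sum>i\<in>I. subst1_term f c i $$ l $$ r)"
        by (intro subst1_nth_nth[OF f]) (auto simp: I_def)
      thus ?thesis by (simp add: D_def fls_nth_sum)
    qed
  qed
  hence "residue2 (subst1 f c * P) = residue2 ((\<Sum>i\<in>I. subst1_term f c i) * P)"
    by (simp add: D_def left_diff_distrib residue2_diff)
  also have "\<dots> = (\<Sum>i\<in>I. residue2 (subst1_term f c i * P))"
    by (simp add: sum_distrib_right residue2_def fls_nth_sum)
  also have "\<dots> = (\<Sum>i\<in>I. c $$ i * residue2 (fps_to_fls f powi i * P))"
    by (simp add: subst1_term_def mult.assoc residue2_def)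
  finally show ?thesis using N(1) by (intro exI[of _ I]) (auto simp: I_def)
qed

text \<open>
  As \<open>g\<close> has order \<open>1\<close> in \<open>y\<close>, the coefficient of \<open>y\<^sup>n\<close> in \<open>h(f,g)\<close> receives contributions only from
  exponents \<open>j \<le> n\<close>; the outer sum is finite in each degree and needs no topology.
\<close>

lemma subst1_mult_powi_nth_eq_0:
  fixes f g :: "'k::field fls fps"
  assumes "fps_nth f 0 \<noteq> 0" "subdegree g = 1" "l < j"
  shows "(subst1 f c * fps_to_fls g powi j) $$ l = 0"
proof (rule fls_mult_nth_eq_0[of 0 _ j])
  show "(fps_to_fls g powi j) $$ i = 0" if "i < j" for i
    using that assms by (intro fls_eq0_below_subdegree) (simp add: fls_subdegree_fls_to_fps)
qed (use assms subst1_nth_neg in auto)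

lemma subst1_zero: "subst1 f 0 = 0"
  unfolding subst1_def coeffwise_infsum_def by (simp flip: zero_fls_def)

lemma subst2_nth:
  fixes f g :: "'k::field fls fps"
  assumes f: "fps_nth f 0 \<noteq> 0" and g: "subdegree g = 1"
    and b: "b \<le> fls_subdegree h" and n: "n \<le> n'"
  shows "subst2 f g h $$ n = (\<Sum>j\<in>{b..n'}. (subst1 f (h $$ j) * fps_to_fls g powi j) $$ n)"
proof -
  let ?T = "\<lambda>j. subst1 f (h $$ j) * fps_to_fls g powi j"
  have 0: "?T j $$ l = 0" if "j \<notin> {b..n'}" "l \<le> n'" for j l
  proof (cases "j < b")
    case True
    thus ?thesis using b by (simp add: subst1_zero)
  next
    case False
    thus ?thesis using that by (intro subst1_mult_powi_nth_eq_0[OF f g]) auto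
  qed
  have "subst2 f g h $$ n = (\<Sum>\<^sub>\<infinity>j. ?T j $$ n)"
    unfolding subst2_def coeffwise_infsum_def
  proof (rule nth_Abs_fls_lower_bound[where N = b], intro allI impI infsum_0)
    fix l j assume "l < b"
    thus "?T j $$ l = 0"
      using b by (cases "j < b") (auto simp: subst1_zero intro!: subst1_mult_powi_nth_eq_0[OF f g])
  qed
  also have "\<dots> = (\<Sum>\<^sub>\<infinity>j\<in>{b..n'}. ?T j $$ n)"
    by (rule infsum_cong_neutral) (use 0 n in auto)
  finally show ?thesis by simp
qed

lemma residue2_change_of_vars_form:
  fixes f g :: "'k::field fls fps"
  assumes f: "fps_nth f 0 \<noteq> 0" and g: "subdegree g = 1"
    and b: "b \<le> fls_subdegree h"
  shows "residue2 (change_of_vars_form f g h) =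
     (\<Sum>j\<in>{b..-1}. residue2 (subst1 f (h $$ j) * (fps_to_fls g powi j * fps_to_fls (jacobian f g))))"
proof -
  let ?T = "\<lambda>j. subst1 f (h $$ j) * fps_to_fls g powi j" and ?J = "fps_to_fls (jacobian f g)"
  have T: "?T j $$ l = 0" if "l < b" "j \<ge> b" for j l
    using that by (intro subst1_mult_powi_nth_eq_0[OF f g]) auto
  have S: "subst2 f g h $$ n = (\<Sum>j\<in>{b..-1}. ?T j) $$ n" if "n \<le> -1" for n
    using subst2_nth[OF f g b that] by (simp add: fls_nth_sum)
  have R: "(\<Sum>j\<in>{b..-1}. ?T j) $$ n = 0" if "n < b" for n
    using that by (auto simp: fls_nth_sum intro!: sum.neutral T)
  have S0: "subst2 f g h $$ n = 0" if "n < b" for n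
  proof -
    have "subst2 f g h $$ n = (\<Sum>j\<in>{b..n}. ?T j $$ n)" by (rule subst2_nth[OF f g b order.refl])
    thus ?thesis using that by simp
  qed
  \<comment> \<open>The Jacobian has no negative powers of \<open>y\<close>, so only the coefficients of \<open>h(f,g)\<close> in degrees up
    to \<open>-1\<close> matter; they agree with those of one finite sum over \<open>j\<close>.\<close>
  have "(subst2 f g h * ?J) $$ -1 = (\<Sum>n\<in>{b..-1-0}. subst2 f g h $$ n * ?J $$ (-1 - n))"
    by (rule fls_times_nth_bounds) (auto simp: S0)
  also have "\<dots> = (\<Sum>n\<in>{b..-1-0}. (\<Sum>j\<in>{b..-1}. ?T j) $$ n * ?J $$ (-1 - n))"
    by (intro sum.cong refl) (simp add: S)
  also have "\<dots> = ((\<Sum>j\<in>{b..-1}. ?T j) * ?J) $$ -1"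
    by (rule fls_times_nth_bounds[symmetric]) (auto simp: R)
  finally show ?thesis
    by (simp add: change_of_vars_form_def residue2_def sum_distrib_right fls_nth_sum mult.assoc)
qed

lemma residue2_monomial:
  fixes f g :: "'k::field fls fps"
  assumes f: "fls_subdegree (fps_nth f 0) = 1" and g: "subdegree g = 1"
  shows "residue2 (fps_to_fls f powi i * (fps_to_fls g powi j * fps_to_fls (jacobian f g))) =
     (if i = -1 \<and> j = -1 then 1 else 0)"
proof -
  let ?F = "fps_to_fls f" and ?G = "fps_to_fls g"
  have nz: "?F \<noteq> 0" "?G \<noteq> 0" using f g by auto
  have "?F powi i * (?G powi j * fps_to_fls (jacobian f g))
    = ?F powi (i + 1) * ?G powi (j + 1) * (inverse ?F * inverse ?G * jac ?F ?G)"
  proof -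
    have powi_Suc: "?F powi (i + 1) = ?F powi i * ?F" "?G powi (j + 1) = ?G powi j * ?G"
      using nz by (simp_all add: power_int_add_1)
    have "?F powi (i + 1) * ?G powi (j + 1) * (inverse ?F * inverse ?G * jac ?F ?G)
      = (?F * inverse ?F) * (?G * inverse ?G) * (?F powi i * (?G powi j * jac ?F ?G))"
      by (simp only: powi_Suc mult_ac)
    moreover have "?F * inverse ?F = 1" "?G * inverse ?G = 1" using nz by simp_all
    ultimately show ?thesis by (simp only: jac_fps_to_fls mult_1_left)
  qed
  moreover have "residue2 (inverse ?F * inverse ?G * jac ?F ?G) = 1"
  proof (rule residue2_dlog_dlog[OF f])
    show "g = fps_X * fps_shift 1 g"
      using g by (metis fps_shift_times_fps_X_power fps_X_power_mult_right_nth mult.commute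
          order.refl power_one_right)
    show "fps_nth (fps_shift 1 g) 0 \<noteq> 0" using g nth_subdegree_nonzero[of g] by force
  qed
  ultimately show ?thesis
    using residue2_dlog[OF nz, of "i + 1" "j + 1"] by auto
qed

lemma subdegree_eq_1:
  fixes p :: "'a::field fps"
  assumes "fps_X dvd p" "\<not> fps_X ^ 2 dvd p"
  shows "subdegree p = 1"
proof -
  have "p \<noteq> 0" using assms(2) by auto
  hence "1 \<le> subdegree p" "\<not> 2 \<le> subdegree p"
    using assms fps_dvd_iff[of fps_X p] fps_dvd_iff[of "fps_X ^ 2" p] by simp_all
  thus ?thesis by simp
qed

lemma admissible_change_subdegrees:
  assumes "admissible_change f g"
  shows "fls_subdegree (fps_nth f 0) = 1" "subdegree g = 1"
proof -
  obtain p where p: "fps_nth f 0 = fps_to_fls p" "fps_X dvd p" "\<not> fps_X ^ 2 dvd p"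
    and g: "fps_X dvd g" "\<not> fps_X ^ 2 dvd g"
    using assms unfolding admissible_change_def by (elim conjE exE)
  show "fls_subdegree (fps_nth f 0) = 1"
    by (simp add: p(1) fls_subdegree_fls_to_fps subdegree_eq_1[OF p(2,3)])
  show "subdegree g = 1" by (rule subdegree_eq_1[OF g])
qed

section \<open>Invariance of the residue\<close>

theorem mainTheorem1:
  fixes f g :: "'k::field fls fps" and h :: "'k fls fls"
  assumes "admissible_change f g"
  shows "residue2 h = residue2 (change_of_vars_form f g h)"
proof -
  note f = admissible_change_subdegrees(1)[OF assms]
  note g = admissible_change_subdegrees(2)[OF assms]
  have f0: "fps_nth f 0 \<noteq> 0" using f by auto
  let ?b = "min (-1) (fls_subdegree h)"
  have "residue2 (subst1 f (h $$ j) * (fps_to_fls g powi j * fps_to_fls (jacobian f g)))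
      = (if j = -1 then residue2 h else 0)" for j
  proof -
    obtain I where "finite I" "-1 \<in> I"
      "residue2 (subst1 f (h $$ j) * (fps_to_fls g powi j * fps_to_fls (jacobian f g))) =
        (\<Sum>i\<in>I. h $$ j $$ i *
           residue2 (fps_to_fls f powi i * (fps_to_fls g powi j * fps_to_fls (jacobian f g))))"
      using residue2_subst1_mult[OF f] by blast
    note this(3)
    also have "(\<Sum>i\<in>I. h $$ j $$ i *
           residue2 (fps_to_fls f powi i * (fps_to_fls g powi j * fps_to_fls (jacobian f g))))
        = (\<Sum>i\<in>I. if i = -1 then (if j = -1 then h $$ j $$ i else 0) else 0)"
      by (rule sum.cong) (simp_all add: residue2_monomial[OF f g])
    also have "\<dots> = (if j = -1 then residue2 h else 0)"
      using \<open>finite I\<close> \<open>-1 \<in> I\<close> by (simp add: residue2_def)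
    finally show ?thesis .
  qed
  thus ?thesis
    using residue2_change_of_vars_form[OF f0 g, of ?b h] by simp
qed

end
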